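(* Let $H$ be a fixed subgraph of a hypercube. If, for some integer $k \geq 1$, $H$ admits a $k$-partite representation, then \[\mathrm{ex}(Q_n, H) = o(e(Q_n)) \quad \text{as } n \to \infty,\] where $e(Q_n) = 2^{n-1} n$ is the number of edges of $Q_n$.
   Context: The hypercube $Q_n$ is the graph with vertex set $\{0,1\}^n$, two vertices being adjacent if they differ in exactly one coordinate. For graphs $G$ and $H$, $\mathrm{ex}(G,H)$ is the maximum number of edges in a subgraph of $G$ containing no copy of $H$ (no subgraph isomorphic to $H$). An edge of $Q_l$ is written as a string $[a_1 \dots a_l]$ with exactly one entry equal to $*$ (the flip-bit) and all other entries in $\{0,1\}$; it joins the two vertices obtained by replacing $*$ by $0$ and by $1$. The non-zero bits of an edge are the positions whose entry is $1$ or $*$. A subgraph $H$ of the cube has a $k$-partite representation if there is an $l$ such that: $H$ is (embedded as) a subgraph of $Q_l$; every edge of $H$ has exactly $k$ non-zero bits ($k-1$ ones and the flip-bit); and there is a function $\sigma:[l]\to[k]$ such that for each edge $e$ of $H$, $\sigma$ maps the set of positions of the non-zero bits of $e$ onto $[k]$ (i.e. no two non-zero bits of $e$ have the same image). The associated representation is the $k$-uniform hypergraph $\mathcal{H}$ on vertex set $[l]$ whose edges are the sets of positions of non-zero bits of the edges of $H$. *)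

theory Defs
  imports Complex_Main "HOL-Library.FuncSet" "HOL-Library.Landau_Symbols"
begin

section \<open>Undirected simple graphs\<close>

record 'a ugraph =
  vertices :: "'a set"
  edges :: "'a set set"

definition simple_graph :: "'a ugraph \<Rightarrow> bool" where
  "simple_graph G \<longleftrightarrow> (\<forall>e\<in>edges G. e \<subseteq> vertices G \<and> card e = 2)"

definition subgraph :: "'a ugraph \<Rightarrow> 'a ugraph \<Rightarrow> bool" where
  "subgraph K G \<longleftrightarrow>
     simple_graph K \<and> simple_graph G \<and> vertices K \<subseteq> vertices G \<and> edges K \<subseteq> edges G"

definition isomorphic :: "'a ugraph \<Rightarrow> 'b ugraph \<Rightarrow> bool" where
  "isomorphic G K \<longleftrightarrow>
     (\<exists>f. bij_betw f (vertices G) (vertices K) \<and> edges K = (\<lambda>e. f ` e) ` edges G)"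

definition contains_copy :: "'a ugraph \<Rightarrow> 'b ugraph \<Rightarrow> bool" where
  "contains_copy G H \<longleftrightarrow> (\<exists>K. subgraph K G \<and> isomorphic H K)"

text \<open>
  For finite \<open>G\<close> the supremum is a maximum, except when \<open>H\<close> has no vertices at all: then every
  graph contains a copy of \<open>H\<close>, and the value is \<open>0\<close>; see \<open>ex_number_eq_Max\<close> below.
\<close>

definition ex_number :: "'a ugraph \<Rightarrow> 'b ugraph \<Rightarrow> nat" where
  "ex_number G H = Sup {card (edges K) | K. subgraph K G \<and> \<not> contains_copy K H}"

section \<open>The hypercube\<close>

text \<open>Coordinates are numbered from \<open>0\<close>, so \<open>[n]\<close> is rendered as \<open>{..<n}\<close>.\<close>

definition hypercube :: "nat \<Rightarrow> bool list ugraph" where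
  "hypercube n =
     \<lparr>vertices = {v. length v = n},
      edges = {{u, v} | u v. length u = n \<and> length v = n \<and>
                             card {i. i < n \<and> u ! i \<noteq> v ! i} = 1}\<rparr>"

datatype edge_entry = Zero | One | Flip

definition edge_string :: "nat \<Rightarrow> bool list set \<Rightarrow> edge_entry list" where
  "edge_string l e =
     map (\<lambda>i. if \<forall>v\<in>e. v ! i then One else if \<forall>v\<in>e. \<not> v ! i then Zero else Flip) [0..<l]"

definition nonzero_bits :: "nat \<Rightarrow> bool list set \<Rightarrow> nat set" where
  "nonzero_bits l e = {i. i < l \<and> edge_string l e ! i \<noteq> Zero}"

section \<open>Partite representations\<close>

text \<open>
  The graph \<open>H'\<close> is the embedded copy of \<open>H\<close> in the cube of dimension \<open>l\<close>.  That cube need not be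
  the one in which \<open>H\<close> was originally given.
\<close>

definition has_partite_representation :: "'a ugraph \<Rightarrow> nat \<Rightarrow> bool" where
  "has_partite_representation H k \<longleftrightarrow>
     (\<exists>l H'. subgraph H' (hypercube l) \<and> isomorphic H H' \<and>
        (\<forall>e\<in>edges H'. card (nonzero_bits l e) = k) \<and>
        (\<exists>\<sigma> \<in> {..<l} \<rightarrow> {..<k}. \<forall>e\<in>edges H'. \<sigma> ` nonzero_bits l e = {..<k}))"

section \<open>Basic facts\<close>

lemma simple_graph_hypercube: "simple_graph (hypercube n)"
proof -
  have "u \<noteq> v" if "card {i. i < n \<and> u ! i \<noteq> v ! i} = 1" for u v :: "bool list"
    using that by auto
  then show ?thesis
    unfolding simple_graph_def hypercube_def by (auto simp: card_insert_if)
qed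

lemma finite_vertices_hypercube: "finite (vertices (hypercube n))"
  using finite_lists_length_eq[of "UNIV :: bool set" n] by (simp add: hypercube_def)

lemma finite_edges_hypercube: "finite (edges (hypercube n))"
proof (rule finite_subset)
  show "edges (hypercube n) \<subseteq> Pow (vertices (hypercube n))"
    using simple_graph_hypercube[of n] by (auto simp: simple_graph_def)
qed (simp add: finite_vertices_hypercube)

lemma edges_hypercube_eq:
  "edges (hypercube n) =
     (\<lambda>(i, v). {v, v[i := True]}) ` (SIGMA i:{..<n}. {v. length v = n \<and> \<not> v ! i})"
  (is "_ = ?R")
proof (intro set_eqI iffI)
  fix e assume "e \<in> edges (hypercube n)"
  then obtain u v where e: "e = {u, v}" and len: "length u = n" "length v = n"
    and "card {i. i < n \<and> u ! i \<noteq> v ! i} = 1"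
    by (auto simp: hypercube_def)
  then obtain i where i: "{i. i < n \<and> u ! i \<noteq> v ! i} = {i}"
    by (auto simp: card_1_singleton_iff)
  then have "i < n" and ne: "u ! i \<noteq> v ! i" and eq: "\<And>j. j < n \<Longrightarrow> j \<noteq> i \<Longrightarrow> u ! j = v ! j"
    by blast+
  show "e \<in> ?R"
  proof (cases "u ! i")
    case True
    then have "u = v[i := True]"
      using len eq True ne \<open>i < n\<close> by (intro nth_equalityI) (auto simp: nth_list_update)
    then show ?thesis using e len \<open>i < n\<close> True ne by (force simp: insert_commute)
  next
    case False
    then have "v = u[i := True]"
      using len eq False ne \<open>i < n\<close> by (intro nth_equalityI) (auto simp: nth_list_update)
    then show ?thesis using e len \<open>i < n\<close> False by force
  qed
next
  fix e assume "e \<in> ?R"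
  then obtain i v where e: "e = {v, v[i := True]}" and iv: "i < n" "length v = n" "\<not> v ! i"
    by auto
  have "{j. j < n \<and> v ! j \<noteq> v[i := True] ! j} = {i}"
    using iv by (auto simp: nth_list_update split: if_splits)
  then show "e \<in> edges (hypercube n)"
    unfolding hypercube_def using e iv(2)
    by (simp, intro exI[of _ v] exI[of _ "v[i := True]"]) simp
qed

lemma card_edges_hypercube: "card (edges (hypercube n)) = 2 ^ (n - 1) * n"
proof -
  define S where "S i = {v :: bool list. length v = n \<and> \<not> v ! i}" for i
  have fin: "finite {v :: bool list. length v = n}"
    using finite_vertices_hypercube[of n] by (simp add: hypercube_def)
  have card_S: "card (S i) = 2 ^ (n - 1)" if "i < n" for i
  proof -
    let ?T = "{v :: bool list. length v = n \<and> v ! i}"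
    have "bij_betw (\<lambda>v. v[i := True]) (S i) ?T"
      using that
      by (intro bij_betwI[where g = "\<lambda>v. v[i := False]"])
         (auto simp: S_def list_update_same_conv)
    then have "card (S i) = card ?T" by (rule bij_betw_same_card)
    moreover have "card (S i \<union> ?T) = card (S i) + card ?T"
      by (intro card_Un_disjoint) (auto simp: S_def intro: finite_subset[OF _ fin])
    moreover have "S i \<union> ?T = {v. length v = n}" by (auto simp: S_def)
    moreover have "card {v :: bool list. length v = n} = 2 ^ n"
      using card_lists_length_eq[of "UNIV :: bool set" n] by simp
    moreover have "(2 :: nat) ^ n = 2 * 2 ^ (n - 1)"
      using that by (cases n) auto
    ultimately show ?thesis by simp
  qed
  have inj: "inj_on (\<lambda>(i, v). {v, v[i := True]}) (SIGMA i:{..<n}. S i)"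
  proof (rule inj_onI, clarsimp)
    fix i v j w
    assume a: "i < n" "v \<in> S i" "j < n" "w \<in> S j" "{v, v[i := True]} = {w, w[j := True]}"
    have "v ! i \<noteq> v[i := True] ! i" "w ! j \<noteq> w[j := True] ! j"
      using a by (auto simp: S_def)
    from a(5) consider "v = w" "v[i := True] = w[j := True]"
      | "v = w[j := True]" "v[i := True] = w"
      by (auto simp: doubleton_eq_iff)
    then show "i = j \<and> v = w"
    proof cases
      case 1
      then have "w[j := True] ! i" using a(1,2) nth_list_update_eq[of i v True] by (simp add: S_def)
      moreover have "\<not> w ! i" using 1(1) a(2) by (simp add: S_def)
      ultimately have "i = j" using nth_list_update_neq[of j i w True] by metis
      then show ?thesis using 1(1) by simp
    next
      case 2
      have *: "w = w[j := True, i := True]" using 2(2) unfolding 2(1) by (rule sym)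
      have "w[j := True, i := True] ! j" using a(3,4) by (cases "i = j") (simp_all add: S_def)
      then have "w ! j" by (subst *)
      then show ?thesis using a(4) by (simp add: S_def)
    qed
  qed
  have "card (edges (hypercube n)) = card (SIGMA i:{..<n}. S i)"
    using card_image[OF inj] by (simp add: edges_hypercube_eq S_def)
  also have "\<dots> = (\<Sum>i<n. card (S i))"
    by (intro card_SigmaI) (auto simp: S_def intro: finite_subset[OF _ fin])
  also have "\<dots> = 2 ^ (n - 1) * n" using card_S by simp
  finally show ?thesis .
qed

lemma ex_number_eq_Max:
  assumes "simple_graph G" and fin: "finite (edges G)" and ne: "vertices H \<noteq> {}"
  shows "ex_number G H = Max {card (edges K) | K. subgraph K G \<and> \<not> contains_copy K H}"
    and "\<exists>K. subgraph K G \<and> \<not> contains_copy K H \<and> card (edges K) = ex_number G H"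
proof -
  let ?A = "{card (edges K) | K. subgraph K G \<and> \<not> contains_copy K H}"
  let ?O = "\<lparr>vertices = {}, edges = {}\<rparr> :: 'a ugraph"
  have "subgraph ?O G" using assms(1) by (simp add: subgraph_def simple_graph_def)
  moreover have "\<not> contains_copy ?O H"
    using ne by (auto simp: contains_copy_def subgraph_def isomorphic_def bij_betw_def)
  ultimately have A: "?A \<noteq> {}" by blast
  have finA: "finite ?A"
    using fin by (intro finite_subset[of ?A "{..card (edges G)}"])
      (auto simp: subgraph_def intro: card_mono)
  show eq: "ex_number G H = Max ?A"
    unfolding ex_number_def Sup_nat_def using A by (simp only: if_False)
  show "\<exists>K. subgraph K G \<and> \<not> contains_copy K H \<and> card (edges K) = ex_number G H"
    using Max_in[OF finA A] unfolding eq by auto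
qed

text \<open>In an edge of the cube exactly one entry is the flip-bit, so an edge with \<open>k\<close> non-zero bits
  has \<open>k - 1\<close> ones.\<close>

lemma ex1_flip:
  assumes "e \<in> edges (hypercube l)"
  shows "\<exists>!i. i < l \<and> edge_string l e ! i = Flip"
proof -
  obtain u v where e: "e = {u, v}" and "card {i. i < l \<and> u ! i \<noteq> v ! i} = 1"
    using assms by (auto simp: hypercube_def)
  then obtain i where i: "{i. i < l \<and> u ! i \<noteq> v ! i} = {i}"
    by (auto simp: card_1_singleton_iff)
  have "(j < l \<and> edge_string l e ! j = Flip) \<longleftrightarrow> j \<in> {i. i < l \<and> u ! i \<noteq> v ! i}" for j
    by (auto simp: e edge_string_def split: if_splits)
  then show ?thesis unfolding i by auto
qed

end

theory Submission imports Defs begin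

text \<open>
  For a vertex \<open>T\<close> of the cube, viewed as a set, let \<open>D T\<close> be the set of \<open>i \<in> T\<close> such that the edge
  from \<open>T - {i}\<close> to \<open>T\<close> is present.  If the graph is dense then many \<open>T\<close> have \<open>D T\<close> of linear size, so
  there are many pairs of a \<open>T\<close> and a \<open>k\<close>-subset \<open>S\<close> of \<open>D T\<close>.  Averaging over \<open>W = T - S\<close> gives a
  \<open>W\<close> for which a positive proportion of all \<open>k\<close>-sets \<open>S\<close> satisfy \<open>S \<subseteq> D (W \<union> S)\<close>.  By
  the theorem of Erdos on \<open>k\<close>-partite \<open>k\<close>-uniform hypergraphs these sets \<open>S\<close> contain a large
  complete \<open>k\<close>-partite hypergraph, into which the representation of \<open>H\<close> embeds; translating by
  \<open>W\<close> yields a copy of \<open>H\<close>.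
\<close>

section \<open>Distinct lists and averaging\<close>

text \<open>Ordered tuples replace \<open>k\<close>-sets, so that a family of \<open>k\<close>-sets
  becomes a \<open>k\<close>-ary relation. Each set is counted \<open>k!\<close> times, which
  affects only constants.\<close>

definition distinct_lists :: "nat \<Rightarrow> 'a set \<Rightarrow> 'a list set" where
  "distinct_lists k A = {xs. length xs = k \<and> distinct xs \<and> set xs \<subseteq> A}"

lemma finite_distinct_lists: "finite A \<Longrightarrow> finite (distinct_lists k A)"
  unfolding distinct_lists_def
  by (rule finite_subset[OF _ finite_lists_length_eq[of A k]]) auto

lemma card_distinct_lists_le:
  assumes "finite A"
  shows "card (distinct_lists k A) \<le> card A ^ k"
proof -
  have "card (distinct_lists k A) \<le> card {xs. set xs \<subseteq> A \<and> length xs = k}"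
    by (rule card_mono[OF finite_lists_length_eq[OF assms]]) (auto simp: distinct_lists_def)
  then show ?thesis using card_lists_length_eq[OF assms] by metis
qed

text \<open>The number of such lists is a falling factorial, and each of its \<open>k\<close>
  factors exceeds \<open>card A - k\<close>.\<close>

lemma card_distinct_lists_ge:
  assumes "finite A" "k \<le> card A"
  shows "(card A - k) ^ k \<le> card (distinct_lists k A)"
proof -
  have "(card A - k) ^ k = (\<Prod>i\<in>{card A - k + 1..card A}. card A - k)"
    using assms(2) by simp
  also have "\<dots> \<le> \<Prod>{card A - k + 1..card A}"
    by (rule prod_mono) auto
  also have "\<dots> = card (distinct_lists k A)"
    unfolding distinct_lists_def by (rule card_lists_distinct_length_eq[OF assms, symmetric])
  finally show ?thesis .
qed

text \<open>A threshold argument in place of convexity: if the sets \<open>N x\<close> have average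
  density \<open>c\<close>, then at least a proportion \<open>c / 2\<close> of the \<open>x\<close>
  have density at least \<open>c / 2\<close>, and these alone contribute enough lists. The constants
  depend only on \<open>c\<close> and \<open>k\<close>.\<close>

lemma sum_card_distinct_lists_ge:
  fixes c :: real
  assumes "c > 0"
  shows "\<exists>c'>(0::real). \<exists>n0. \<forall>(X :: 'a set) (A :: 'b set) N.
    finite X \<longrightarrow> finite A \<longrightarrow> n0 \<le> card A \<longrightarrow> (\<forall>x\<in>X. N x \<subseteq> A) \<longrightarrow>
    c * card X * card A \<le> (\<Sum>x\<in>X. card (N x)) \<longrightarrow>
    c' * card X * card A ^ k \<le> (\<Sum>x\<in>X. card (distinct_lists k (N x)))"
\<comment> \<open>The factor \<open>c / 2\<close> is the proportion of dense \<open>x\<close>. The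
  threshold \<open>4 * k / c\<close> gives \<open>k \<le> c * n / 4\<close>, so that
  \<open>c / 2 * n - k\<close> is still at least \<open>c / 4 * n\<close>; the extra
  \<open>1\<close> makes \<open>n\<close> positive.\<close>
proof (rule exI[of _ "c / 2 * (c / 4) ^ k"], intro conjI exI[of _ "nat \<lceil>4 * k / c\<rceil> + 1"] allI impI)
  show "c / 2 * (c / 4) ^ k > 0" using assms by simp
  fix X :: "'a set" and A :: "'b set" and N
  assume fin: "finite X" "finite A" and large: "nat \<lceil>4 * k / c\<rceil> + 1 \<le> card A"
    and N: "\<forall>x\<in>X. N x \<subseteq> A" and dense: "c * card X * card A \<le> (\<Sum>x\<in>X. card (N x))"
  define n where "n = card A"
  have "n > 0" using large by (simp add: n_def)
  have "4 * k / c \<le> n" using large unfolding n_def by linarith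
  then have kn: "k \<le> c * n / 4" using assms by (simp add: field_simps)
  define B where "B = {x \<in> X. c / 2 * n \<le> card (N x)}"
  have finB: "finite B" "B \<subseteq> X" using fin by (auto simp: B_def)
  have "real (\<Sum>x\<in>X. card (N x)) = (\<Sum>x\<in>B. real (card (N x))) + (\<Sum>x\<in>X - B. real (card (N x)))"
    using sum.subset_diff[OF finB(2) fin(1), of "\<lambda>x. real (card (N x))"] by simp
  also have "(\<Sum>x\<in>B. real (card (N x))) \<le> card B * real n"
    using N finB by (intro sum_bounded_above) (auto simp: n_def intro!: card_mono fin(2))
  also have "(\<Sum>x\<in>X - B. real (card (N x))) \<le> card (X - B) * (c / 2 * n)"
    by (rule sum_bounded_above) (auto simp: B_def)
  also have "\<dots> \<le> card X * (c / 2 * n)"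
    using assms fin by (intro mult_right_mono) (auto intro: card_mono)
  finally have "(c / 2 * card X) * n \<le> card B * real n"
    using dense by (simp add: n_def algebra_simps)
  then have B_large: "c / 2 * card X \<le> card B" using \<open>n > 0\<close> by simp
  have each: "(c / 4 * n) ^ k \<le> card (distinct_lists k (N x))" if "x \<in> B" for x
  proof -
    have d: "c / 2 * n \<le> card (N x)" using that by (simp add: B_def)
    have "finite (N x)" using that finB N fin(2) by (meson finite_subset subsetD)
    have "0 \<le> c * n" using assms by simp
    have kd: "k \<le> card (N x)" using kn d \<open>0 \<le> c * n\<close> by linarith
    have "(c / 4 * n) ^ k \<le> real (card (N x) - k) ^ k"
      using kn d kd assms by (intro power_mono) (auto simp: of_nat_diff)
    also have "\<dots> = real ((card (N x) - k) ^ k)" by simp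
    also have "\<dots> \<le> card (distinct_lists k (N x))"
      using card_distinct_lists_ge[OF \<open>finite (N x)\<close> kd] by (simp only: of_nat_le_iff)
    finally show ?thesis .
  qed
  have "c / 2 * (c / 4) ^ k * card X * n ^ k = (c / 2 * card X) * (c / 4 * n) ^ k"
    using power_mult_distrib[of "c / 4" "real n" k] by simp
  also have "\<dots> \<le> card B * (c / 4 * n) ^ k"
    using B_large assms by (intro mult_right_mono) auto
  also have "\<dots> \<le> (\<Sum>x\<in>B. real (card (distinct_lists k (N x))))"
    by (rule sum_bounded_below[OF each])
  also have "\<dots> \<le> (\<Sum>x\<in>X. real (card (distinct_lists k (N x))))"
    using finB fin by (intro sum_mono2) auto
  finally show "c / 2 * (c / 4) ^ k * card X * card A ^ k
      \<le> (\<Sum>x\<in>X. card (distinct_lists k (N x)))"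
    by (simp add: n_def)
qed

lemma exists_ge_average:
  fixes c :: real
  assumes "finite Y" "Y \<noteq> {}" "c * card Y \<le> (\<Sum>y\<in>Y. f y)"
  shows "\<exists>y\<in>Y. c \<le> f y"
proof (rule ccontr)
  assume "\<not> ?thesis"
  then have "(\<Sum>y\<in>Y. f y) < (\<Sum>y\<in>Y. c)"
    using assms(1,2) by (intro sum_strict_mono) auto
  then show False using assms(3) by (simp add: mult.commute)
qed

section \<open>Complete multipartite subrelations of dense relations\<close>

text \<open>
  The theorem of Erdos, for \<open>k\<close>-ary relations; \<open>f i\<close> enumerates the \<open>i\<close>-th part.
\<close>

lemma dense_relation_contains_box:
  fixes c :: real and k t :: nat
  assumes "c > 0"
  shows "\<exists>n0. \<forall>(A :: 'a set) R. finite A \<longrightarrow> n0 \<le> card A \<longrightarrow>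
    R \<subseteq> {xs. set xs \<subseteq> A \<and> length xs = k} \<longrightarrow> c * card A ^ k \<le> card R \<longrightarrow>
    (\<exists>f. (\<forall>i<k. inj_on (f i) {..<t}) \<and>
      (\<forall>js. (\<forall>i<k. js i < t) \<longrightarrow> map (\<lambda>i. f i (js i)) [0..<k] \<in> R))"
  using assms
proof (induction k arbitrary: c)
  case 0
  have "[] \<in> R" if "R \<subseteq> {xs. set xs \<subseteq> A \<and> length xs = 0}" "c * card A ^ 0 \<le> card R"
    for A :: "'a set" and R
  proof -
    \<comment> \<open>For arity \<open>0\<close> the density bound reads
      \<open>c \<le> card R\<close>, and \<open>c\<close> is positive.\<close>
    have "R \<noteq> {}" using that(2) 0 by auto
    then show ?thesis using that(1) by auto
  qed
  then show ?case by auto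
next
  case (Suc k)
  \<comment> \<open>The induction hypothesis is applied with the smaller density \<open>c'\<close>,
    which has to be fixed before \<open>A\<close> and \<open>R\<close>.\<close>
  obtain c' :: real and n1 where "c' > 0" and average:
    "\<forall>(X :: 'a list set) (A :: 'a set) N.
      finite X \<longrightarrow> finite A \<longrightarrow> n1 \<le> card A \<longrightarrow> (\<forall>x\<in>X. N x \<subseteq> A) \<longrightarrow>
      c * card X * card A \<le> (\<Sum>x\<in>X. card (N x)) \<longrightarrow>
      c' * card X * card A ^ t \<le> (\<Sum>x\<in>X. card (distinct_lists t (N x)))"
    using sum_card_distinct_lists_ge[OF Suc.prems, of t] by (elim exE conjE) (rule that)
  obtain n2 where box:
    "\<forall>(A :: 'a set) R. finite A \<longrightarrow> n2 \<le> card A \<longrightarrow>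
      R \<subseteq> {xs. set xs \<subseteq> A \<and> length xs = k} \<longrightarrow> c' * card A ^ k \<le> card R \<longrightarrow>
      (\<exists>f. (\<forall>i<k. inj_on (f i) {..<t}) \<and>
        (\<forall>js. (\<forall>i<k. js i < t) \<longrightarrow> map (\<lambda>i. f i (js i)) [0..<k] \<in> R))"
    using Suc.IH[OF \<open>c' > 0\<close>] by (elim exE) (rule that)
  have "\<exists>f. (\<forall>i<Suc k. inj_on (f i) {..<t}) \<and>
      (\<forall>js. (\<forall>i<Suc k. js i < t) \<longrightarrow> map (\<lambda>i. f i (js i)) [0..<Suc k] \<in> R)"
    if fin: "finite A" and large: "n1 + n2 + t \<le> card A"
      and R: "R \<subseteq> {xs. set xs \<subseteq> A \<and> length xs = Suc k}" and dense: "c * card A ^ Suc k \<le> card R"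
    for A :: "'a set" and R
  proof -
    \<comment> \<open>The relation is split into tails \<open>ys\<close> and the heads that extend
      them. The aim is a list of \<open>t\<close> distinct heads with a positive proportion of all
      tails in common.\<close>
    define X where "X = {ys. set ys \<subseteq> A \<and> length ys = k}"
    define N where "N ys = {x. x # ys \<in> R}" for ys
    have finX: "finite X" and cardX: "card X = card A ^ k"
      unfolding X_def using fin by (simp_all add: finite_lists_length_eq card_lists_length_eq)
    have NA: "\<forall>ys\<in>X. N ys \<subseteq> A" using R by (auto simp: N_def)
    then have finN: "\<forall>ys\<in>X. finite (N ys)" using fin by (meson finite_subset)
    have "R = (\<lambda>(ys, x). x # ys) ` (SIGMA ys:X. N ys)"
    proof (intro set_eqI iffI)
      fix zs assume "zs \<in> R"
      moreover then obtain x ys where "zs = x # ys" "ys \<in> X"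
        using R by (cases zs) (auto simp: X_def)
      ultimately show "zs \<in> (\<lambda>(ys, x). x # ys) ` (SIGMA ys:X. N ys)"
        by (intro image_eqI[of _ _ "(ys, x)"]) (auto simp: N_def)
    qed (auto simp: N_def)
    moreover have "inj_on (\<lambda>(ys, x). x # ys) (SIGMA ys:X. N ys)" by (auto simp: inj_on_def)
    ultimately have "card R = card (SIGMA ys:X. N ys)" by (metis card_image)
    also have "\<dots> = (\<Sum>ys\<in>X. card (N ys))" using finX finN by (rule card_SigmaI)
    finally have "c * card X * card A \<le> (\<Sum>ys\<in>X. card (N ys))"
      using dense by (simp add: cardX algebra_simps)
    then have "c' * card X * card A ^ t \<le> (\<Sum>ys\<in>X. card (distinct_lists t (N ys)))"
      using finX fin NA large by (intro average[rule_format]) auto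
    also have "(\<Sum>ys\<in>X. card (distinct_lists t (N ys)))
        = (\<Sum>ys\<in>X. card {us \<in> distinct_lists t A. set us \<subseteq> N ys})"
      by (rule sum.cong) (use NA in \<open>auto simp: distinct_lists_def intro!: arg_cong[of _ _ card]\<close>)
    \<comment> \<open>Double counting: the pairs of a tail and \<open>t\<close> distinct heads
      extending it are now grouped by the heads.\<close>
    also have "\<dots> = (\<Sum>us\<in>distinct_lists t A. card {ys \<in> X. set us \<subseteq> N ys})"
      by (rule sum_multicount_gen[OF finX finite_distinct_lists[OF fin]]) simp
    finally have sum_ge: "c' * card X * card A ^ t
      \<le> (\<Sum>us\<in>distinct_lists t A. real (card {ys \<in> X. set us \<subseteq> N ys}))"
      by simp
    have "c' * card X * card (distinct_lists t A) \<le> c' * card X * card A ^ t"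
      using card_distinct_lists_le[OF fin, of t] \<open>c' > 0\<close>
      by (intro mult_left_mono) (auto simp flip: of_nat_power)
    with sum_ge have avg: "c' * card X * card (distinct_lists t A)
      \<le> (\<Sum>us\<in>distinct_lists t A. real (card {ys \<in> X. set us \<subseteq> N ys}))"
      by linarith
    \<comment> \<open>This makes the family of head lists nonempty, as averaging over it
      requires.\<close>
    have "t \<le> card A" using large by simp
    then obtain B where "B \<subseteq> A" "card B = t" "finite B"
      by (meson obtain_subset_with_card_n)
    moreover then obtain us where "set us = B" "distinct us"
      using finite_distinct_list by blast
    ultimately have "us \<in> distinct_lists t A"
      by (auto simp: distinct_lists_def distinct_card)
    then have "distinct_lists t A \<noteq> {}" by auto
    from exists_ge_average[OF finite_distinct_lists[OF fin] this avg]
    obtain us where us: "us \<in> distinct_lists t A"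
      and us_large: "c' * card X \<le> card {ys \<in> X. set us \<subseteq> N ys}"
      by auto
    have "\<exists>f. (\<forall>i<k. inj_on (f i) {..<t}) \<and> (\<forall>js. (\<forall>i<k. js i < t) \<longrightarrow>
        map (\<lambda>i. f i (js i)) [0..<k] \<in> {ys \<in> X. set us \<subseteq> N ys})"
    proof (rule box[rule_format, OF fin])
      show "n2 \<le> card A" using large by simp
      show "{ys \<in> X. set us \<subseteq> N ys} \<subseteq> {ys. set ys \<subseteq> A \<and> length ys = k}"
        by (auto simp: X_def)
      show "c' * card A ^ k \<le> card {ys \<in> X. set us \<subseteq> N ys}"
        using us_large by (simp add: cardX)
    qed
    then obtain f where inj: "\<forall>i<k. inj_on (f i) {..<t}"
      and f: "\<And>js. \<forall>i<k. js i < t \<Longrightarrow>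
        map (\<lambda>i. f i (js i)) [0..<k] \<in> {ys \<in> X. set us \<subseteq> N ys}"
      by (elim exE conjE) (rule that, assumption, rule mp, erule spec)
    \<comment> \<open>The common heads \<open>us\<close> become part \<open>0\<close>, and the parts
      found among their common tails are shifted by one.\<close>
    define g where "g i = (case i of 0 \<Rightarrow> (\<lambda>j. us ! j) | Suc i' \<Rightarrow> f i')" for i
    have "inj_on (g i) {..<t}" if "i < Suc k" for i
      using that inj us
      by (cases i) (auto simp: g_def distinct_lists_def inj_on_def nth_eq_iff_index_eq)
    moreover have "map (\<lambda>i. g i (js i)) [0..<Suc k] \<in> R" if js: "\<forall>i<Suc k. js i < t" for js
    proof -
      have "map (\<lambda>i. f i (js (Suc i))) [0..<k] \<in> {ys \<in> X. set us \<subseteq> N ys}"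
        using js by (intro f) auto
      moreover have "us ! js 0 \<in> set us" using us js by (auto simp: distinct_lists_def)
      ultimately have "us ! js 0 # map (\<lambda>i. f i (js (Suc i))) [0..<k] \<in> R"
        by (auto simp: N_def)
      then show ?thesis by (simp add: map_upt_Suc g_def del: upt_Suc)
    qed
    ultimately show ?thesis by blast
  qed
  then show ?case by blast
qed

section \<open>Cube edges as pairs of sets\<close>

definition indicator_list :: "nat \<Rightarrow> nat set \<Rightarrow> bool list" where
  "indicator_list n S = map (\<lambda>i. i \<in> S) [0..<n]"

definition ones :: "bool list \<Rightarrow> nat set" where
  "ones v = {i. i < length v \<and> v ! i}"

text \<open>This is \<open>D T\<close> of the overview; each edge is recorded at its upper endpoint
  only, by its direction.\<close>

definition down_edges :: "nat \<Rightarrow> bool list set set \<Rightarrow> nat set \<Rightarrow> nat set" where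
  "down_edges n E T = {i \<in> T. {indicator_list n (T - {i}), indicator_list n T} \<in> E}"

lemma indicator_list_inject:
  assumes "S \<subseteq> {..<n}" "T \<subseteq> {..<n}" "indicator_list n S = indicator_list n T"
  shows "S = T"
proof -
  have "i \<in> S \<longleftrightarrow> i \<in> T" if "i < n" for i
    using arg_cong[OF assms(3), of "\<lambda>v. v ! i"] that by (simp add: indicator_list_def)
  then show ?thesis using assms(1,2) by blast
qed

lemma indicator_list_ones: "indicator_list (length v) (ones v) = v"
  by (rule nth_equalityI) (auto simp: indicator_list_def ones_def)

lemma hypercube_edge_cases:
  assumes "e \<in> edges (hypercube n)"
  obtains v i where "e = {v, v[i := True]}" "length v = n" "i < n" "\<not> v ! i"
  using assms by (auto simp: edges_hypercube_eq)

lemma ones_list_update: "i < length v \<Longrightarrow> ones (v[i := True]) = insert i (ones v)"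
  by (auto simp: ones_def nth_list_update split: if_splits)

text \<open>An edge is determined by its upper endpoint \<open>T\<close> and its direction
  \<open>i\<close>, so the pairs with \<open>i\<close> in \<open>down_edges n E T\<close> cover
  \<open>E\<close>.\<close>

lemma card_edges_le_sum_down_edges:
  assumes "E \<subseteq> edges (hypercube n)"
  shows "card E \<le> (\<Sum>T\<in>Pow {..<n}. card (down_edges n E T))"
proof -
  let ?S = "SIGMA T:Pow {..<n}. down_edges n E T"
  let ?h = "\<lambda>(T, i). {indicator_list n (T - {i}), indicator_list n T}"
  have fin: "finite (down_edges n E T)" if "T \<in> Pow {..<n}" for T
    using that by (auto simp: down_edges_def intro: finite_subset)
  have "E \<subseteq> ?h ` ?S"
  proof
    fix e assume "e \<in> E"
    with assms obtain v i where e: "e = {v, v[i := True]}" and v: "length v = n" "i < n" "\<not> v ! i"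
      by (meson hypercube_edge_cases subsetD)
    have T: "indicator_list n (ones (v[i := True])) = v[i := True]"
      using indicator_list_ones[of "v[i := True]"] v by simp
    have "ones (v[i := True]) - {i} = ones v"
      using v by (auto simp: ones_list_update) (auto simp: ones_def)
    then have T': "indicator_list n (ones (v[i := True]) - {i}) = v"
      using indicator_list_ones[of v] v by simp
    have "i \<in> down_edges n E (ones (v[i := True]))"
      using \<open>e \<in> E\<close> e T T' v by (simp add: down_edges_def ones_list_update)
    moreover have "ones (v[i := True]) \<subseteq> {..<n}" using v by (auto simp: ones_def)
    ultimately show "e \<in> ?h ` ?S"
      using e T T' by (intro image_eqI[of _ _ "(ones (v[i := True]), i)"]) auto
  qed
  then have "card E \<le> card ?S"
    using fin by (intro surj_card_le) auto
  also have "\<dots> = (\<Sum>T\<in>Pow {..<n}. card (down_edges n E T))"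
    using fin by (intro card_SigmaI) auto
  finally show ?thesis .
qed

text \<open>Translates string notation into sets: the non-zero bits of an edge form its upper
  endpoint, and the flip-bit is its direction.\<close>

lemma nonzero_bits_edge:
  assumes "length v = l" "i < l"
  shows "nonzero_bits l {v, v[i := True]} = insert i (ones v)"
proof -
  have "edge_string l {v, v[i := True]} ! j \<noteq> Zero \<longleftrightarrow> v ! j \<or> j = i" if "j < l" for j
    using that assms by (simp add: edge_string_def nth_list_update)
  then show ?thesis using assms by (auto simp: nonzero_bits_def ones_def)
qed

section \<open>Finding a copy\<close>

lemma contains_copy_isomorphic:
  assumes "isomorphic H H'" "contains_copy K H'"
  shows "contains_copy K H"
proof -
  obtain f where f: "bij_betw f (vertices H) (vertices H')" "edges H' = (\<lambda>e. f ` e) ` edges H"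
    using assms(1) by (auto simp: isomorphic_def)
  obtain L g where L: "subgraph L K"
    and g: "bij_betw g (vertices H') (vertices L)" "edges L = (\<lambda>e. g ` e) ` edges H'"
    using assms(2) by (auto simp: contains_copy_def isomorphic_def)
  have "bij_betw (g \<circ> f) (vertices H) (vertices L)" using f g by (auto intro: bij_betw_trans)
  moreover have "edges L = (\<lambda>e. (g \<circ> f) ` e) ` edges H" using f g by (auto simp: image_comp)
  ultimately show ?thesis using L unfolding contains_copy_def isomorphic_def by blast
qed

text \<open>Isolated vertices of \<open>H\<close> can be placed anywhere, so only the edges matter.\<close>

lemma contains_copyI:
  assumes "simple_graph H" "finite (vertices H)" "simple_graph K" "finite (vertices K)"
    and card: "card (vertices H) \<le> card (vertices K)"
    and inj: "inj_on g (\<Union>(edges H))" and edge: "\<And>e. e \<in> edges H \<Longrightarrow> g ` e \<in> edges K"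
  shows "contains_copy K H"
proof -
  define U where "U = \<Union>(edges H)"
  have U: "U \<subseteq> vertices H" using assms(1) by (auto simp: U_def simple_graph_def)
  have gU: "g ` U \<subseteq> vertices K"
    using edge assms(3) by (fastforce simp: U_def simple_graph_def)
  have finU: "finite U" using U assms(2) by (rule finite_subset)
  \<comment> \<open>As \<open>g\<close> is injective on \<open>U\<close>, removing \<open>U\<close>
    and its image leaves enough free vertices of \<open>K\<close> for the isolated vertices of
    \<open>H\<close>.\<close>
  have "card (vertices H - U) \<le> card (vertices K - g ` U)"
    using card finU U gU inj card_image[of g U]
    by (simp add: card_Diff_subset U_def[symmetric])
  then obtain h where h: "h ` (vertices H - U) \<subseteq> vertices K - g ` U" "inj_on h (vertices H - U)"
    using card_le_inj[of "vertices H - U" "vertices K - g ` U"] assms(2,4) by auto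
  define f where "f v = (if v \<in> U then g v else h v)" for v
  have "inj_on f (vertices H)"
    using inj h by (fastforce simp: f_def inj_on_def U_def[symmetric])
  have fK: "f ` vertices H \<subseteq> vertices K" using gU h(1) by (auto simp: f_def)
  have fe: "f ` e = g ` e" if "e \<in> edges H" for e
    using that by (intro image_cong) (auto simp: f_def U_def)
  define L where "L = \<lparr>vertices = f ` vertices H, edges = (\<lambda>e. f ` e) ` edges H\<rparr>"
  have "edges L \<subseteq> edges K" using fe edge by (auto simp: L_def)
  moreover have "simple_graph L"
    using \<open>edges L \<subseteq> edges K\<close> assms(1,3) by (auto simp: L_def simple_graph_def)
  ultimately have "subgraph L K" using fK assms(3) by (simp add: subgraph_def L_def)
  moreover have "isomorphic H L"
    using \<open>inj_on f (vertices H)\<close> by (auto simp: isomorphic_def L_def bij_betw_def)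
  ultimately show ?thesis by (auto simp: contains_copy_def)
qed

text \<open>Position \<open>j\<close> of the small cube is sent to the \<open>j\<close>-th element
  of part \<open>\<sigma> j\<close>, and a vertex to the union of \<open>W\<close> with the image of
  its ones. The non-zero bits of an edge meet every colour once, so their image is a tuple of the
  box and the image of the edge lies in \<open>K\<close>.\<close>

lemma contains_copy_if_box:
  assumes K: "subgraph K (hypercube n)" and H: "subgraph H (hypercube l)"
    and card: "card (vertices H) \<le> card (vertices K)"
    and rep: "\<forall>e\<in>edges H. card (nonzero_bits l e) = k"
    and \<sigma>: "\<sigma> \<in> {..<l} \<rightarrow> {..<k}" "\<forall>e\<in>edges H. \<sigma> ` nonzero_bits l e = {..<k}"
    and W: "W \<subseteq> {..<n}"
    and inj: "\<forall>c<k. inj_on (f c) {..<l}"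
    and box: "\<And>js. \<forall>c<k. js c < l \<Longrightarrow> map (\<lambda>c. f c (js c)) [0..<k] \<in>
      {xs \<in> distinct_lists k ({..<n} - W). set xs \<subseteq> down_edges n (edges K) (W \<union> set xs)}"
  shows "contains_copy K H"
proof -
  define \<phi> where "\<phi> j = f (\<sigma> j) j" for j
  have \<phi>_mem: "\<phi> j \<in> {..<n} - W" if "j < l" for j
  proof -
    have "map (\<lambda>c. f c j) [0..<k] \<in> distinct_lists k ({..<n} - W)"
      using box[of "\<lambda>_. j"] that by simp
    moreover have "\<phi> j \<in> set (map (\<lambda>c. f c j) [0..<k])"
      using \<sigma>(1) that by (fastforce simp: \<phi>_def)
    ultimately show ?thesis unfolding distinct_lists_def by blast
  qed
  have \<phi>_inj: "inj_on \<phi> {..<l}"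
  proof (rule inj_onI)
    fix i j assume ij: "i \<in> {..<l}" "j \<in> {..<l}" "\<phi> i = \<phi> j"
    have "\<sigma> i < k" "\<sigma> j < k" using \<sigma>(1) ij by auto
    show "i = j"
    proof (cases "\<sigma> i = \<sigma> j")
      case True
      then show ?thesis using inj ij \<open>\<sigma> j < k\<close> by (auto simp: \<phi>_def inj_on_def)
    next
      case False
      \<comment> \<open>Two positions of different colours occur together in one tuple of the box,
        whose entries are distinct.\<close>
      define js where "js c = (if c = \<sigma> i then i else j)" for c
      have "\<forall>c<k. js c < l" using ij by (simp add: js_def)
      then have "distinct (map (\<lambda>c. f c (js c)) [0..<k])"
        using box[of js] by (simp add: distinct_lists_def)
      from nth_eq_iff_index_eq[OF this, of "\<sigma> i" "\<sigma> j"]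
      have "f (\<sigma> i) (js (\<sigma> i)) \<noteq> f (\<sigma> j) (js (\<sigma> j))"
        using False \<open>\<sigma> i < k\<close> \<open>\<sigma> j < k\<close> by simp
      then show ?thesis using ij False by (auto simp: js_def \<phi>_def)
    qed
  qed
  define g where "g v = indicator_list n (W \<union> \<phi> ` ones v)" for v
  have len: "length v = l" if "v \<in> \<Union>(edges H)" for v
    using that H by (fastforce simp: subgraph_def simple_graph_def hypercube_def)
  have "inj_on g (\<Union>(edges H))"
  proof (rule inj_onI)
    fix u v assume uv: "u \<in> \<Union>(edges H)" "v \<in> \<Union>(edges H)" "g u = g v"
    have o: "ones u \<subseteq> {..<l}" "ones v \<subseteq> {..<l}" using uv len by (auto simp: ones_def)
    have "W \<union> \<phi> ` ones u = W \<union> \<phi> ` ones v"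
      using uv(3) W o \<phi>_mem unfolding g_def by (intro indicator_list_inject[of _ n]) auto
    moreover have "\<phi> ` ones u \<inter> W = {}" "\<phi> ` ones v \<inter> W = {}" using o \<phi>_mem by blast+
    ultimately have "\<phi> ` ones u = \<phi> ` ones v" by blast
    then have "ones u = ones v" using \<phi>_inj o by (simp add: inj_on_image_eq_iff)
    then show "u = v" using indicator_list_ones[of u] indicator_list_ones[of v] uv len by metis
  qed
  moreover have "g ` e \<in> edges K" if "e \<in> edges H" for e
  proof -
    have "e \<in> edges (hypercube l)" using that H by (auto simp: subgraph_def)
    then obtain v i where e: "e = {v, v[i := True]}" and v: "length v = l" "i < l" "\<not> v ! i"
      by (rule hypercube_edge_cases)
    define A where "A = insert i (ones v)"
    have A: "A \<subseteq> {..<l}" using v by (auto simp: A_def ones_def)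
    have nz: "nonzero_bits l e = A" using nonzero_bits_edge[OF v(1,2)] e A_def by simp
    then have "card A = k" and \<sigma>A: "\<sigma> ` A = {..<k}" using rep \<sigma>(2) that by auto
    then have \<sigma>_inj: "inj_on \<sigma> A" using A by (intro eq_card_imp_inj_on) (auto intro: finite_subset)
    \<comment> \<open>\<open>js c\<close> is the only position of colour \<open>c\<close> in
      \<open>A\<close>, so the tuple of the box with indices \<open>js\<close> has entry set exactly
      \<open>\<phi>\<close> followed by the image of \<open>A\<close>.\<close>
    define js where "js = inv_into A \<sigma>"
    have js: "js c \<in> A" "\<sigma> (js c) = c" if "c < k" for c
      using that \<sigma>A unfolding js_def by (auto intro: inv_into_into f_inv_into_f)
    let ?xs = "map (\<lambda>c. f c (js c)) [0..<k]"
    have "set ?xs = (\<lambda>c. f c (js c)) ` {..<k}" by (simp add: atLeast0LessThan)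
    also have "\<dots> = (\<lambda>c. \<phi> (js c)) ` {..<k}"
      by (rule image_cong) (simp_all add: \<phi>_def js)
    also have "\<dots> = \<phi> ` js ` \<sigma> ` A" by (simp only: image_image \<sigma>A[symmetric])
    also have "js ` \<sigma> ` A = A"
      unfolding js_def by (rule inv_into_image_cancel[OF \<sigma>_inj subset_refl])
    finally have xs: "set ?xs = \<phi> ` A" .
    have "?xs \<in> {xs \<in> distinct_lists k ({..<n} - W).
        set xs \<subseteq> down_edges n (edges K) (W \<union> set xs)}"
      by (rule box) (use js A in auto)
    then have "set ?xs \<subseteq> down_edges n (edges K) (W \<union> set ?xs)" by simp
    \<comment> \<open>All directions in the image of \<open>A\<close> are present at this vertex,
      hence so is the one of the flip-bit, whichever position of \<open>A\<close> that is.\<close>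
    then have "\<phi> i \<in> down_edges n (edges K) (W \<union> \<phi> ` A)"
      unfolding xs by (auto simp: A_def)
    then have *: "{indicator_list n (W \<union> \<phi> ` A - {\<phi> i}), indicator_list n (W \<union> \<phi> ` A)} \<in> edges K"
      by (simp add: down_edges_def)
    have "i \<notin> ones v" using v by (simp add: ones_def)
    then have "\<phi> i \<notin> \<phi> ` ones v" using \<phi>_inj A by (auto simp: A_def dest: inj_onD)
    then have "W \<union> \<phi> ` A - {\<phi> i} = W \<union> \<phi> ` ones v"
      using \<phi>_mem[OF v(2)] by (auto simp: A_def)
    with * have "{g v, g (v[i := True])} \<in> edges K"
      using v by (simp add: g_def ones_list_update A_def[symmetric])
    then show ?thesis by (simp add: e)
  qed
  ultimately show ?thesis
    using K H card finite_vertices_hypercube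
    by (intro contains_copyI[of H K g]) (auto simp: subgraph_def intro: finite_subset)
qed

section \<open>Boxes above a common base set in dense subgraphs of the cube\<close>

text \<open>Pairs of a vertex \<open>T\<close> and a \<open>k\<close>-tuple from \<open>D T\<close>
  are regrouped by the base \<open>W = T - set xs\<close>. Some base then carries a positive
  proportion of all \<open>k\<close>-tuples, and the theorem of Erdos applies to these with parts of
  size \<open>l\<close>.\<close>

lemma dense_contains_box:
  fixes \<epsilon> :: real and k l :: nat
  assumes "\<epsilon> > 0"
  shows "\<exists>n0. \<forall>n\<ge>n0. \<forall>E \<subseteq> edges (hypercube n). \<epsilon> * card (edges (hypercube n)) \<le> card E \<longrightarrow>
    (\<exists>W f. W \<subseteq> {..<n} \<and> (\<forall>c<k. inj_on (f c) {..<l}) \<and>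
      (\<forall>js. (\<forall>c<k. js c < l) \<longrightarrow> map (\<lambda>c. f c (js c)) [0..<k] \<in>
        {xs \<in> distinct_lists k ({..<n} - W). set xs \<subseteq> down_edges n E (W \<union> set xs)}))"
proof -
  obtain c :: real and n1 where "c > 0" and average:
    "\<forall>(X :: nat set set) (A :: nat set) N.
      finite X \<longrightarrow> finite A \<longrightarrow> n1 \<le> card A \<longrightarrow> (\<forall>x\<in>X. N x \<subseteq> A) \<longrightarrow>
      \<epsilon> / 2 * card X * card A \<le> (\<Sum>x\<in>X. card (N x)) \<longrightarrow>
      c * card X * card A ^ k \<le> (\<Sum>x\<in>X. card (distinct_lists k (N x)))"
    using sum_card_distinct_lists_ge[OF half_gt_zero[OF assms], of k]
    by (elim exE conjE) (rule that)
  obtain n2 where box: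
    "\<forall>(A :: nat set) R. finite A \<longrightarrow> n2 \<le> card A \<longrightarrow>
      R \<subseteq> {xs. set xs \<subseteq> A \<and> length xs = k} \<longrightarrow> c * card A ^ k \<le> card R \<longrightarrow>
      (\<exists>f. (\<forall>i<k. inj_on (f i) {..<l}) \<and>
        (\<forall>js. (\<forall>i<k. js i < l) \<longrightarrow> map (\<lambda>i. f i (js i)) [0..<k] \<in> R))"
    using dense_relation_contains_box[OF \<open>c > 0\<close>, of k l] by (elim exE) (rule that)
  have "\<exists>W f. W \<subseteq> {..<n} \<and> (\<forall>c<k. inj_on (f c) {..<l}) \<and>
      (\<forall>js. (\<forall>c<k. js c < l) \<longrightarrow> map (\<lambda>c. f c (js c)) [0..<k] \<in>
        {xs \<in> distinct_lists k ({..<n} - W). set xs \<subseteq> down_edges n E (W \<union> set xs)})"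
    if n: "n1 + n2 + 1 \<le> n" and E: "E \<subseteq> edges (hypercube n)"
      and dense: "\<epsilon> * card (edges (hypercube n)) \<le> card E" for n E
  proof -
    define D where "D = down_edges n E"
    define R where "R W = {xs \<in> distinct_lists k ({..<n} - W). set xs \<subseteq> D (W \<union> set xs)}" for W
    let ?P = "Pow {..<n}"
    have D: "D T \<subseteq> T" for T by (auto simp: D_def down_edges_def)
    have finR: "finite (R W)" for W
      unfolding R_def by (simp add: finite_distinct_lists)
    have finD: "finite (distinct_lists k (D T))" if "T \<in> ?P" for T
      using that D[of T] by (intro finite_distinct_lists) (meson finite_lessThan finite_subset PowD)
    \<comment> \<open>The cube has \<open>n / 2\<close> edges per vertex, so edge density
      \<open>\<epsilon>\<close> means that \<open>D T\<close> has average size at least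
      \<open>\<epsilon> / 2 * n\<close>.\<close>
    have "\<epsilon> / 2 * card ?P * card {..<n} = \<epsilon> * card (edges (hypercube n))"
      using n by (cases n) (simp_all add: card_Pow card_edges_hypercube algebra_simps)
    also have "\<dots> \<le> (\<Sum>T\<in>?P. card (D T))"
      using dense card_edges_le_sum_down_edges[OF E] unfolding D_def by linarith
    finally have "c * card ?P * card {..<n} ^ k \<le> (\<Sum>T\<in>?P. card (distinct_lists k (D T)))"
      using D n by (intro average[rule_format]) auto
    also have "(\<Sum>T\<in>?P. card (distinct_lists k (D T))) = card (SIGMA T:?P. distinct_lists k (D T))"
      using finD by (intro card_SigmaI[symmetric]) auto
    also have "\<dots> \<le> card (SIGMA W:?P. R W)"
    \<comment> \<open>Since \<open>set xs \<subseteq> T\<close>, adding the entries of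
      \<open>xs\<close> back to the base recovers \<open>T\<close>.\<close>
    proof (rule card_inj_on_le[of "\<lambda>(T, xs). (T - set xs, xs)"])
      show "inj_on (\<lambda>(T, xs). (T - set xs, xs)) (SIGMA T:?P. distinct_lists k (D T))"
      proof (rule inj_on_inverseI[of _ "\<lambda>(W, xs). (W \<union> set xs, xs)"])
        fix p assume "p \<in> (SIGMA T:?P. distinct_lists k (D T))"
        then obtain T xs where "p = (T, xs)" "set xs \<subseteq> D T" by (auto simp: distinct_lists_def)
        then show "(case case p of (T, xs) \<Rightarrow> (T - set xs, xs) of (W, xs) \<Rightarrow> (W \<union> set xs, xs)) = p"
          using D[of T] by auto
      qed
      show "(\<lambda>(T, xs). (T - set xs, xs)) ` (SIGMA T:?P. distinct_lists k (D T)) \<subseteq> (SIGMA W:?P. R W)"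
      proof clarsimp
        fix T xs assume T: "T \<subseteq> {..<n}" and xs: "xs \<in> distinct_lists k (D T)"
        have "set xs \<subseteq> T" using xs D[of T] by (auto simp: distinct_lists_def)
        then have "T - set xs \<union> set xs = T" by auto
        then have "xs \<in> R (T - set xs)"
          using xs T \<open>set xs \<subseteq> T\<close> by (auto simp: R_def distinct_lists_def)
        then show "T - set xs \<subseteq> {..<n} \<and> xs \<in> R (T - set xs)" using T by auto
      qed
    qed (use finR in auto)
    also have "\<dots> = (\<Sum>W\<in>?P. card (R W))" using finR by (intro card_SigmaI) auto
    finally have "(c * n ^ k) * card ?P \<le> (\<Sum>W\<in>?P. real (card (R W)))"
      by (simp add: algebra_simps)
    then obtain W where W: "W \<in> ?P" "c * n ^ k \<le> card (R W)"
      using exists_ge_average[of ?P "c * n ^ k" "\<lambda>W. real (card (R W))"] by blast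
    have "R W \<subseteq> {xs. set xs \<subseteq> {..<n} \<and> length xs = k}"
      by (auto simp: R_def distinct_lists_def)
    then have "\<exists>f. (\<forall>i<k. inj_on (f i) {..<l}) \<and>
        (\<forall>js. (\<forall>i<k. js i < l) \<longrightarrow> map (\<lambda>i. f i (js i)) [0..<k] \<in> R W)"
      using W n by (intro box[rule_format, of "{..<n}"]) auto
    then show ?thesis using W(1) unfolding R_def D_def by (intro exI[of _ W]) simp
  qed
  then show ?thesis by (intro exI[of _ "n1 + n2 + 1"]) blast
qed

text \<open>It suffices to embed \<open>H'\<close>, the copy of \<open>H\<close> that carries the
  representation. The box provides room for its edges, and a large \<open>n\<close> provides room
  for its isolated vertices.\<close>

lemma dense_contains_copy:
  fixes \<epsilon> :: real
  assumes "\<epsilon> > 0" "has_partite_representation H k"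
  shows "\<exists>n0. \<forall>n\<ge>n0. \<forall>K. subgraph K (hypercube n) \<longrightarrow>
    \<epsilon> * card (edges (hypercube n)) \<le> card (edges K) \<longrightarrow> contains_copy K H"
proof -
  obtain l H' \<sigma> where H': "subgraph H' (hypercube l)" "isomorphic H H'"
    and rep: "\<forall>e\<in>edges H'. card (nonzero_bits l e) = k"
    and \<sigma>: "\<sigma> \<in> {..<l} \<rightarrow> {..<k}" "\<forall>e\<in>edges H'. \<sigma> ` nonzero_bits l e = {..<k}"
    using assms(2) by (auto simp: has_partite_representation_def)
  obtain n1 where n1: "\<forall>n\<ge>n1. \<forall>E \<subseteq> edges (hypercube n).
    \<epsilon> * card (edges (hypercube n)) \<le> card E \<longrightarrow>
    (\<exists>W f. W \<subseteq> {..<n} \<and> (\<forall>c<k. inj_on (f c) {..<l}) \<and>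
      (\<forall>js. (\<forall>c<k. js c < l) \<longrightarrow> map (\<lambda>c. f c (js c)) [0..<k] \<in>
        {xs \<in> distinct_lists k ({..<n} - W). set xs \<subseteq> down_edges n E (W \<union> set xs)}))"
    using dense_contains_box[OF assms(1), of k l] by (elim exE) (rule that)
  define p where "p = card (vertices H')"
  have "contains_copy K H"
    if n: "n1 + nat \<lceil>2 ^ p / \<epsilon>\<rceil> + 1 \<le> n" and K: "subgraph K (hypercube n)"
      and dense: "\<epsilon> * card (edges (hypercube n)) \<le> card (edges K)" for n K
  proof -
    have finK: "finite (vertices K)"
      using K finite_vertices_hypercube by (auto simp: subgraph_def intro: finite_subset)
    \<comment> \<open>The threshold on \<open>n\<close> forces more than \<open>2 ^ p\<close> edges
      in \<open>K\<close>. Edges are sets of vertices, so \<open>K\<close> has at most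
      \<open>2 ^ card (vertices K)\<close> of them and hence at least \<open>p\<close>
      vertices.\<close>
    have "2 ^ p / \<epsilon> < n" using n by linarith
    then have "2 ^ p < \<epsilon> * n" using assms(1) by (simp add: field_simps)
    also have "\<dots> \<le> \<epsilon> * card (edges (hypercube n))"
      using assms(1) by (simp add: card_edges_hypercube mult_le_cancel_right1)
    also have "\<dots> \<le> card (edges K)" by (rule dense)
    also have "card (edges K) \<le> card (Pow (vertices K))"
      using K finK by (intro card_mono) (auto simp: subgraph_def simple_graph_def)
    also have "real (card (Pow (vertices K))) = 2 ^ card (vertices K)"
      using finK by (simp add: card_Pow)
    finally have p: "p \<le> card (vertices K)" by simp
    have "edges K \<subseteq> edges (hypercube n)" using K by (simp add: subgraph_def)
    moreover have "n1 \<le> n" using n by simp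
    ultimately obtain W f where W: "W \<subseteq> {..<n}" and inj: "\<forall>c<k. inj_on (f c) {..<l}"
      and box: "\<forall>js. (\<forall>c<k. js c < l) \<longrightarrow> map (\<lambda>c. f c (js c)) [0..<k] \<in>
        {xs \<in> distinct_lists k ({..<n} - W). set xs \<subseteq> down_edges n (edges K) (W \<union> set xs)}"
      using n1[rule_format, OF _ _ dense] by (elim meta_impE exE conjE) assumption+
    then have "contains_copy K H'"
      by (intro contains_copy_if_box[OF K H'(1) p[unfolded p_def] rep \<sigma> W inj] box[rule_format]) blast
    then show ?thesis using H'(2) contains_copy_isomorphic by blast
  qed
  then show ?thesis by blast
qed

section \<open>From dense subgraphs to the extremal number\<close>

theorem theorem1p1:
  fixes H :: "bool list ugraph" and m k :: nat
  assumes "subgraph H (hypercube m)"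
    and "k \<ge> 1"
    and "has_partite_representation H k"
  shows "(\<lambda>n. real (ex_number (hypercube n) H)) \<in> o(\<lambda>n. real (card (edges (hypercube n))))"
proof (rule landau_o.smallI)
  fix \<epsilon> :: real assume "\<epsilon> > 0"
  obtain n0 where n0: "\<forall>n\<ge>n0. \<forall>K. subgraph K (hypercube n) \<longrightarrow>
      \<epsilon> * card (edges (hypercube n)) \<le> card (edges K) \<longrightarrow> contains_copy K H"
    using dense_contains_copy[OF \<open>\<epsilon> > 0\<close> assms(3)] by blast
  have "real (ex_number (hypercube n) H) \<le> \<epsilon> * card (edges (hypercube n))" if "n \<ge> n0" for n
  proof (cases "vertices H = {}")
    case True
    then have "edges H = {}" using assms(1) by (auto simp: subgraph_def simple_graph_def)
    have "contains_copy K H" if "subgraph K (hypercube n)" for K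
      using that True \<open>edges H = {}\<close> contains_copyI[of H K id] finite_vertices_hypercube
      by (auto simp: subgraph_def simple_graph_def intro: finite_subset)
    then have "ex_number (hypercube n) H = Sup {}"
      unfolding ex_number_def by (intro arg_cong[of _ _ Sup]) blast
    then show ?thesis using \<open>\<epsilon> > 0\<close> by simp
  next
    case False
    \<comment> \<open>The extremal number is attained by a subgraph \<open>K\<close> without a copy
      of \<open>H\<close>; for \<open>n \<ge> n0\<close> such a \<open>K\<close> cannot have density
      \<open>\<epsilon>\<close> or more.\<close>
    then obtain K where "subgraph K (hypercube n)" "\<not> contains_copy K H"
      "card (edges K) = ex_number (hypercube n) H"
      using ex_number_eq_Max(2)[OF simple_graph_hypercube finite_edges_hypercube False] by blast
    then show ?thesis using n0 that by fastforce
  qed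
  then show "\<forall>\<^sub>F n in at_top. norm (real (ex_number (hypercube n) H))
      \<le> \<epsilon> * norm (real (card (edges (hypercube n))))"
    by (auto simp: eventually_at_top_linorder)
qed

end
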